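(* Let $X$ be a Banach space and let $T\in B[X]$ be any bounded linear operator on $X$, with normed-space adjoint $T^*\in B[X^*]$. Then: (a$_1$) If $\overline{\mathcal R(T)}$ is complemented in $X$, then $\mathcal N(T^* )$ is complemented in $X^*$. (a$_2$) If $X$ is reflexive and $\mathcal N(T^* )$ is complemented in $X^*$, then $\overline{\mathcal R(T)}$ is complemented in $X$. (b$_1$) If $X$ is reflexive and $\overline{\mathcal R(T^* )}$ is complemented in $X^*$, then $\mathcal N(T)$ is complemented in $X$. (b$_2$) If $\mathcal R(T)$ is closed in $X$ and $\mathcal N(T)$ is complemented in $X$, then $\mathcal R(T^* )$ is closed in $X^*$ and complemented in $X^*$.
   Context: For a normed space $Y$, $B[Y]$ is the algebra of bounded linear operators on $Y$; a subspace of $Y$ means a norm-closed linear manifold of $Y$. A subspace $M$ of $Y$ is complemented in $Y$ if there is a subspace (norm-closed linear manifold) $N$ of $Y$ with $M+N=Y$ and $M\cap N=\{0\}$. For an operator $S$, $\mathcal R(S)$ and $\mathcal N(S)$ denote its range and kernel, and $\overline{\mathcal R(S)}$ is the norm closure of the range. $X^*$ is the (norm) dual of $X$, and the normed-space adjoint $T^*\in B[X^*]$ of $T\in B[X]$ is given by $T^*f=f\circ T$. *)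

theory Defs
  imports "HOL-Analysis.Analysis"
begin

(* Scalar fields: up to isomorphism exactly the real and the complex numbers with
   their absolute values, so that real and complex Banach spaces are treated at once. *)
class real_or_complex = real_normed_field +
  assumes real_or_complex:
    "(\<forall>z. \<exists>a. z = a *\<^sub>R 1) \<or>
     (\<exists>i. i * i = - 1 \<and> (\<forall>z. \<exists>a b. z = a *\<^sub>R 1 + b *\<^sub>R i) \<and>
          (\<forall>a b. norm (a *\<^sub>R 1 + b *\<^sub>R i) = sqrt (a\<^sup>2 + b\<^sup>2)))"

instance real :: real_or_complex
  by standard auto

instance complex :: real_or_complex
proof
  have "z = Re z *\<^sub>R 1 + Im z *\<^sub>R \<i>" for z :: complex
    by (simp add: complex_eq_iff)
  moreover have "norm (a *\<^sub>R 1 + b *\<^sub>R \<i>) = sqrt (a\<^sup>2 + b\<^sup>2)" for a b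
    by (simp add: cmod_def)
  ultimately show "(\<forall>z::complex. \<exists>a. z = a *\<^sub>R 1) \<or>
     (\<exists>i::complex. i * i = - 1 \<and> (\<forall>z. \<exists>a b. z = a *\<^sub>R 1 + b *\<^sub>R i) \<and>
          (\<forall>a b. norm (a *\<^sub>R 1 + b *\<^sub>R i) = sqrt (a\<^sup>2 + b\<^sup>2)))"
    by (intro disjI2 exI[of _ \<i>] conjI allI) (simp, blast+)
qed

(* "smul" makes the type 'a a normed space over 'k, compatibly with the real
   normed space structure that 'a carries as a type. *)
definition normed_space_over :: "('k::real_or_complex \<Rightarrow> 'a::real_normed_vector \<Rightarrow> 'a) \<Rightarrow> bool" where
  "normed_space_over smul \<longleftrightarrow>
     vector_space smul \<and>
     (\<forall>r x. smul (of_real r) x = r *\<^sub>R x) \<and>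
     (\<forall>c x. norm (smul c x) = norm c * norm x)"

lemma normed_space_over_real: "normed_space_over (scaleR :: real \<Rightarrow> 'a::real_normed_vector \<Rightarrow> 'a)"
  unfolding normed_space_over_def using real_vector.vector_space_axioms by auto

(* Bounded operators on the normed space over 'k: the real-linear bounded maps
   that are homogeneous over 'k. *)
definition bounded_operators :: "('k::real_or_complex \<Rightarrow> 'a::real_normed_vector \<Rightarrow> 'a) \<Rightarrow> ('a \<Rightarrow>\<^sub>L 'a) set" where
  "bounded_operators smul = {T. \<forall>c x. blinfun_apply T (smul c x) = smul c (blinfun_apply T x)}"

(* The dual: the bounded 'k-linear functionals, with the operator norm inherited from
   the type of bounded real-linear maps into 'k. *)
definition dual_space :: "('k::real_or_complex \<Rightarrow> 'a::real_normed_vector \<Rightarrow> 'a) \<Rightarrow> ('a \<Rightarrow>\<^sub>L 'k) set" where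
  "dual_space smul = {f. \<forall>c x. blinfun_apply f (smul c x) = c * blinfun_apply f x}"

definition dual_scale :: "'k::real_or_complex \<Rightarrow> ('a::real_normed_vector \<Rightarrow>\<^sub>L 'k) \<Rightarrow> ('a \<Rightarrow>\<^sub>L 'k)" where
  "dual_scale c f = blinfun_mult_right c o\<^sub>L f"

lemma dual_scale_apply [simp]: "blinfun_apply (dual_scale c f) x = c * blinfun_apply f x"
  by (simp add: dual_scale_def)

lemma dual_space_real: "dual_space (scaleR :: real \<Rightarrow> 'a::real_normed_vector \<Rightarrow> 'a) = UNIV"
  by (auto simp: dual_space_def blinfun.scaleR_right)

(* By this lemma, closedness and closures in the dual agree with those in the
   ambient type. *)
lemma closed_dual_space: "closed (dual_space smul)"
proof -
  have "dual_space smul =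
      (\<Inter>c. \<Inter>x. {f. blinfun_apply f (smul c x) = c * blinfun_apply f x})"
    by (auto simp: dual_space_def)
  also have "closed \<dots>"
    by (intro closed_INT ballI closed_Collect_eq continuous_intros)
  finally show ?thesis .
qed

definition normed_adjoint :: "('a::real_normed_vector \<Rightarrow>\<^sub>L 'a) \<Rightarrow> ('a \<Rightarrow>\<^sub>L 'k::real_or_complex) \<Rightarrow> ('a \<Rightarrow>\<^sub>L 'k)" where
  "normed_adjoint T f = f o\<^sub>L T"

lemma normed_adjoint_in_dual_space:
  assumes "T \<in> bounded_operators smul" "f \<in> dual_space smul"
  shows "normed_adjoint T f \<in> dual_space smul"
  using assms by (simp add: bounded_operators_def dual_space_def normed_adjoint_def)

(* Subspaces of the normed space with carrier V; V is always UNIV or a dual space here. *)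
definition closed_subspace_of ::
    "('k::real_or_complex \<Rightarrow> 'b::real_normed_vector \<Rightarrow> 'b) \<Rightarrow> 'b set \<Rightarrow> 'b set \<Rightarrow> bool" where
  "closed_subspace_of smul V M \<longleftrightarrow> M \<subseteq> V \<and> module.subspace smul M \<and> closed M"

definition complemented_in ::
    "('k::real_or_complex \<Rightarrow> 'b::real_normed_vector \<Rightarrow> 'b) \<Rightarrow> 'b set \<Rightarrow> 'b set \<Rightarrow> bool" where
  "complemented_in smul V M \<longleftrightarrow>
     closed_subspace_of smul V M \<and>
     (\<exists>N. closed_subspace_of smul V N \<and> {x + y | x y. x \<in> M \<and> y \<in> N} = V \<and> M \<inter> N = {0})"

(* Elements of the bidual are functions of which only the values on the dual matter. *)
definition bidual :: "('k::real_or_complex \<Rightarrow> 'a::real_normed_vector \<Rightarrow> 'a) \<Rightarrow> (('a \<Rightarrow>\<^sub>L 'k) \<Rightarrow> 'k) set" where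
  "bidual smul = {\<phi>.
     (\<forall>f\<in>dual_space smul. \<forall>g\<in>dual_space smul. \<phi> (f + g) = \<phi> f + \<phi> g) \<and>
     (\<forall>c. \<forall>f\<in>dual_space smul. \<phi> (dual_scale c f) = c * \<phi> f) \<and>
     (\<exists>B. \<forall>f\<in>dual_space smul. norm (\<phi> f) \<le> B * norm f)}"

definition reflexive_space :: "('k::real_or_complex \<Rightarrow> 'a::real_normed_vector \<Rightarrow> 'a) \<Rightarrow> bool" where
  "reflexive_space smul \<longleftrightarrow>
     (\<forall>\<phi>\<in>bidual smul. \<exists>x. \<forall>f\<in>dual_space smul. \<phi> f = blinfun_apply f x)"

end

theory Submission
  imports Defs
begin

text \<open>
  The assertions are duality statements about annihilators. Write \<open>M\<^sup>\<bottom>\<close> for the functionals that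
  vanish on \<open>M\<close> and \<open>\<^sup>\<bottom>V\<close> for the common zeros of a set \<open>V\<close> of functionals. The kernel of the
  adjoint is the annihilator of the closure of the range of \<open>T\<close>, and, conversely, this closure is
  the preannihilator of that kernel; the kernel of \<open>T\<close> is the preannihilator of the closure of the
  range of the adjoint. The two facts that recover a subspace of the space from the dual rest on the Hahn-Banach
  theorem.

  Complements then pass through these correspondences. A complemented pair \<open>M\<close>, \<open>N\<close> of a Banach
  space has a bounded projection, by the open mapping theorem, and composing functionals with it
  shows that \<open>M\<^sup>\<bottom>\<close> and \<open>N\<^sup>\<bottom>\<close> are complementary (\<open>complemented_annihilator\<close>). In the other direction
  a complemented pair \<open>V\<close>, \<open>W\<close> of the dual has a bounded projection \<open>Q\<close>, and its transpose acts on
  the bidual; when the space is reflexive, this transpose maps points to points and so splits the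
  space into the preannihilators of \<open>V\<close> and \<open>W\<close> (\<open>complemented_preannihilator\<close>).

  The first lemma gives the first assertion, the second lemma gives the two that assume
  reflexivity. In the last assertion the closedness of the range of \<open>T\<close> makes the range of the
  adjoint equal to the whole annihilator of the kernel
  (\<open>range_adjoint_eq_annihilator_kernel\<close>), which is closed as every annihilator is, and the first
  lemma applies again.
\<close>

section \<open>Completeness of the scalar field\<close>

text \<open>
  One coordinate system serves both scalar fields: over the reals \<open>j\<close> and the coordinate
  \<open>im\<close> are zero, over the complex numbers \<open>j\<close> is an imaginary unit. One
  formula then recovers a homogeneous functional from its real part over either field.
\<close>
lemma real_or_complex_coordinates:
  obtains re im :: "'k::real_or_complex \<Rightarrow> real" and j :: 'k
  where "bounded_linear re" "bounded_linear im" "re 1 = 1" "re j = 0"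
    "\<And>z. z = re z *\<^sub>R 1 + im z *\<^sub>R j" "j * j = -1 \<or> j = 0 \<and> (\<forall>z. im z = 0)"
proof -
  consider (real) "\<forall>z::'k. \<exists>a. z = a *\<^sub>R 1"
    | (complex) j :: 'k where "j * j = -1" "\<And>z::'k. \<exists>a b. z = a *\<^sub>R 1 + b *\<^sub>R j"
        "\<And>a b. norm (a *\<^sub>R 1 + b *\<^sub>R j) = sqrt (a\<^sup>2 + b\<^sup>2)"
    using real_or_complex by metis
  then show thesis
  proof cases
    case real
    then obtain re :: "'k \<Rightarrow> real" where re: "\<And>z. z = re z *\<^sub>R 1"
      by metis
    have uniq: "re (a *\<^sub>R 1) = a" for a
      using re[of "a *\<^sub>R 1"] by simp
    have "bounded_linear re"
    proof (rule bounded_linear_intro[where K = 1])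
      show "re (x + y) = re x + re y" for x y
        using uniq[of "re x + re y"] re[of x] re[of y] by (simp add: scaleR_left_distrib)
      show "re (r *\<^sub>R x) = r *\<^sub>R re x" for r x
        using uniq[of "r * re x"] re[of x] by (metis scaleR_scaleR real_scaleR_def)
      show "norm (re x) \<le> norm x * 1" for x
        using arg_cong[OF re[of x], of norm] by simp
    qed
    moreover have "re 1 = 1" "re 0 = 0"
      using uniq[of 1] uniq[of 0] by simp_all
    ultimately show thesis
      using that[of re "\<lambda>_. 0" 0] re by simp
  next
    case complex
    from complex(2) obtain re im :: "'k \<Rightarrow> real" where rep: "\<And>z. z = re z *\<^sub>R 1 + im z *\<^sub>R j"
      by metis
    have uniq: "re (a *\<^sub>R 1 + b *\<^sub>R j) = a \<and> im (a *\<^sub>R 1 + b *\<^sub>R j) = b" for a b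
    proof -
      define z where "z = a *\<^sub>R 1 + b *\<^sub>R j"
      have "(re z - a) *\<^sub>R 1 + (im z - b) *\<^sub>R j = (re z *\<^sub>R 1 + im z *\<^sub>R j) - z"
        unfolding z_def by (simp add: algebra_simps)
      then have "(re z - a) *\<^sub>R 1 + (im z - b) *\<^sub>R j = 0"
        using rep[of z] by simp
      then have "(re z - a)\<^sup>2 + (im z - b)\<^sup>2 = 0"
        using complex(3)[of "re z - a" "im z - b"] by simp
      then show ?thesis
        by (simp add: sum_power2_eq_zero_iff z_def)
    qed
    have add: "re (x + y) = re x + re y \<and> im (x + y) = im x + im y" for x y
    proof -
      have "x + y = (re x + re y) *\<^sub>R 1 + (im x + im y) *\<^sub>R j"
        by (subst rep[of x], subst rep[of y]) (simp add: algebra_simps)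
      then show ?thesis
        using uniq by metis
    qed
    have scale: "re (r *\<^sub>R x) = r * re x \<and> im (r *\<^sub>R x) = r * im x" for r x
    proof -
      have "r *\<^sub>R x = (r * re x) *\<^sub>R 1 + (r * im x) *\<^sub>R j"
        by (subst rep[of x]) (simp add: algebra_simps)
      then show ?thesis
        using uniq by metis
    qed
    have bound: "\<bar>re x\<bar> \<le> norm x \<and> \<bar>im x\<bar> \<le> norm x" for x
    proof -
      have "norm x = sqrt ((re x)\<^sup>2 + (im x)\<^sup>2)"
        using complex(3)[of "re x" "im x"] rep[of x] by simp
      then show ?thesis
        by simp
    qed
    have "bounded_linear re" "bounded_linear im"
      by (rule bounded_linear_intro[where K = 1]; use add scale bound in simp)+
    moreover have "re 1 = 1" "re j = 0"
      using uniq[of 1 0] uniq[of 0 1] by simp_all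
    ultimately show thesis
      using that[of re im j] rep complex(1) by blast
  qed
qed

text \<open>
  Completeness of the scalars makes the bounded maps into them a Banach space, so that the open
  mapping theorem is available in the dual.
\<close>
instance real_or_complex \<subseteq> banach
proof
  fix X :: "nat \<Rightarrow> 'a"
  assume "Cauchy X"
  obtain re im :: "'a \<Rightarrow> real" and j where c: "bounded_linear re" "bounded_linear im"
    "\<And>z. z = re z *\<^sub>R 1 + im z *\<^sub>R j"
    by (rule real_or_complex_coordinates) blast
  have "Cauchy (\<lambda>n. re (X n))" "Cauchy (\<lambda>n. im (X n))"
    using c \<open>Cauchy X\<close> by (auto intro: bounded_linear.Cauchy)
  then obtain a b where "(\<lambda>n. re (X n)) \<longlonglongrightarrow> a" "(\<lambda>n. im (X n)) \<longlonglongrightarrow> b"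
    by (auto simp: Cauchy_convergent_iff convergent_def)
  then have "(\<lambda>n. re (X n) *\<^sub>R 1 + im (X n) *\<^sub>R j) \<longlonglongrightarrow> a *\<^sub>R 1 + b *\<^sub>R j"
    by (intro tendsto_intros)
  then show "convergent X"
    by (simp flip: c(3)) (rule convergentI)
qed

section \<open>Extension of bounded functionals\<close>

lemma normed_space_over_simps:
  assumes "normed_space_over smul"
  shows normed_space_over_module: "module smul"
    and normed_space_over_of_real: "smul (of_real r) x = r *\<^sub>R x"
    and normed_space_over_norm: "norm (smul c x) = norm c * norm x"
    and normed_space_over_bounded_linear: "bounded_linear (smul c)"
proof -
  interpret vector_space smul
    using assms by (simp add: normed_space_over_def)
  show "module smul" by (rule module_axioms)
  show real: "smul (of_real r) x = r *\<^sub>R x" for r x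
    using assms by (simp add: normed_space_over_def)
  show norm: "norm (smul c x) = norm c * norm x" for c x
    using assms by (simp add: normed_space_over_def)
  show "bounded_linear (smul c)"
  proof (rule bounded_linear_intro[where K = "norm c"])
    show "smul c (r *\<^sub>R x) = r *\<^sub>R smul c x" for r x
      by (simp flip: real add: mult.commute)
  qed (auto simp: scale_right_distrib norm mult.commute)
qed

text \<open>
  A functional dominated by \<open>C * norm x\<close> on a subspace is represented by its graph. The bound
  forces \<open>r = 0\<close> whenever \<open>(0, r)\<close> is in the graph, so every dominated subspace of the product is
  automatically single-valued, and Zorn's lemma applies directly to such subspaces ordered by
  inclusion. A maximal one is total: otherwise a point \<open>(x0, \<alpha>)\<close> could be added, since the
  triangle inequality leaves room for an admissible value \<open>\<alpha>\<close>.
\<close>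
lemma Hahn_Banach_real_graph:
  fixes G :: "('a::real_normed_vector \<times> real) set"
  assumes "0 \<le> C" "subspace G" and bound: "\<And>x r. (x, r) \<in> G \<Longrightarrow> \<bar>r\<bar> \<le> C * norm x"
  obtains h where "bounded_linear h" "\<And>x r. (x, r) \<in> G \<Longrightarrow> h x = r"
proof -
  define A where "A = {K :: ('a \<times> real) set. subspace K \<and> G \<subseteq> K \<and> (\<forall>(x, r)\<in>K. \<bar>r\<bar> \<le> C * norm x)}"
  have "\<exists>K\<in>A. \<forall>L\<in>A. K \<subseteq> L \<longrightarrow> L = K"
  proof (rule subset_Zorn_nonempty)
    show "A \<noteq> {}"
      using assms by (auto simp: A_def)
    fix \<C> assume ne: "\<C> \<noteq> {}" and ch: "subset.chain A \<C>"
    have dir: "\<exists>K\<in>\<C>. p \<in> K \<and> q \<in> K" if "p \<in> \<Union>\<C>" "q \<in> \<Union>\<C>" for p q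
      using that subset.chain_total[OF ch] by blast
    have inA: "\<C> \<subseteq> A"
      using ch by (simp add: subset.chain_def)
    then have sub: "subspace K" if "K \<in> \<C>" for K
      using that by (auto simp: A_def)
    have "subspace (\<Union>\<C>)"
      unfolding subspace_def
    proof (intro conjI ballI allI)
      show "0 \<in> \<Union>\<C>"
        using ne sub subspace_0 by auto
      show "p + q \<in> \<Union>\<C>" if "p \<in> \<Union>\<C>" "q \<in> \<Union>\<C>" for p q
        using dir[OF that] sub subspace_add by blast
      show "c *\<^sub>R p \<in> \<Union>\<C>" if "p \<in> \<Union>\<C>" for c p
        using that sub subspace_scale by blast
    qed
    moreover have "G \<subseteq> K" if "K \<in> \<C>" for K
      using that inA by (auto simp: A_def)
    then have "G \<subseteq> \<Union>\<C>"
      using ne by blast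
    moreover have "\<bar>r\<bar> \<le> C * norm x" if "(x, r) \<in> K" "K \<in> \<C>" for x r K
      using that inA by (auto simp: A_def)
    ultimately show "\<Union>\<C> \<in> A"
      by (auto simp: A_def)
  qed
  then obtain K where "K \<in> A" and max: "\<And>L. L \<in> A \<Longrightarrow> K \<subseteq> L \<Longrightarrow> L = K"
    by blast
  then have K: "subspace K" "G \<subseteq> K" "\<And>x r. (x, r) \<in> K \<Longrightarrow> \<bar>r\<bar> \<le> C * norm x"
    by (auto simp: A_def)
  have K0: "(0, 0) \<in> K"
    using subspace_0[OF K(1)] by (simp add: zero_prod_def)
  have Kadd: "(x + y, r + s) \<in> K" if "(x, r) \<in> K" "(y, s) \<in> K" for x y r s
    using subspace_add[OF K(1) that] by simp
  have Kscale: "(c *\<^sub>R x, c * r) \<in> K" if "(x, r) \<in> K" for c x r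
    using subspace_scale[OF K(1) that, of c] by simp
  have Kdiff: "(x - y, r - s) \<in> K" if "(x, r) \<in> K" "(y, s) \<in> K" for x y r s
    using subspace_diff[OF K(1) that] by simp
  have total: "\<exists>r. (x0, r) \<in> K" for x0
  proof -
    have gap: "- (C * norm (x + x0)) - r \<le> C * norm (y + x0) - s" if "(x, r) \<in> K" "(y, s) \<in> K" for x y r s
    proof -
      have "s - r \<le> C * norm (y - x)"
        using K(3)[OF Kdiff[OF that(2,1)]] by simp
      also have "\<dots> \<le> C * (norm (y + x0) + norm (x + x0))"
        using \<open>0 \<le> C\<close> norm_triangle_ineq4[of "y + x0" "x + x0"] by (intro mult_left_mono) auto
      finally show ?thesis
        by (simp add: algebra_simps)
    qed
    \<comment> \<open>The supremum of the lower bounds on an admissible value at \<open>x0\<close>; by the gap estimate it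
      does not exceed any of the upper bounds.\<close>
    define \<alpha> where "\<alpha> = (SUP (x, r)\<in>K. - (C * norm (x + x0)) - r)"
    have lower: "- (C * norm (x + x0)) - r \<le> \<alpha>" if "(x, r) \<in> K" for x r
      unfolding \<alpha>_def
    proof (rule cSUP_upper2[where x = "(x, r)"])
      show "bdd_above ((\<lambda>(x, r). - (C * norm (x + x0)) - r) ` K)"
        using gap[OF _ K0] by (intro bdd_aboveI2[where M = "C * norm (0 + x0) - 0"]) auto
    qed (use that in auto)
    have upper: "\<alpha> \<le> C * norm (x + x0) - r" if "(x, r) \<in> K" for x r
      unfolding \<alpha>_def using gap[OF _ that] K0 by (intro cSUP_least) auto
    define L where "L = span (insert (x0, \<alpha>) K)"
    have "K \<subseteq> L" "(x0, \<alpha>) \<in> L" "subspace L"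
      using span_superset[of "insert (x0, \<alpha>) K"] by (auto simp: L_def)
    moreover have "\<bar>r\<bar> \<le> C * norm x" if "(x, r) \<in> L" for x r
    proof -
      obtain t where t: "(x - t *\<^sub>R x0, r - t * \<alpha>) \<in> K"
        using \<open>(x, r) \<in> L\<close> K(1) by (auto simp: L_def span_breakdown_eq span_eq_iff[THEN iffD2])
      show ?thesis
      proof (cases "t = 0")
        case True
        then show ?thesis
          using K(3)[OF t] by simp
      next
        case False
        \<comment> \<open>Rescaling reduces the bound to the coefficient one at \<open>(x0, \<alpha>)\<close>.\<close>
        then have "(x /\<^sub>R t - x0, r / t - \<alpha>) \<in> K"
          using Kscale[OF t, of "1 / t"] by (simp add: algebra_simps divide_inverse)
        from lower[OF this] upper[OF this] have "\<bar>r / t\<bar> \<le> C * norm (x /\<^sub>R t)"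
          by simp
        then show ?thesis
          using False by (simp add: abs_divide divide_inverse) (simp add: field_simps)
      qed
    qed
    ultimately have "L = K"
      using K(2) by (intro max) (auto simp: A_def)
    then show ?thesis
      using \<open>(x0, \<alpha>) \<in> L\<close> by blast
  qed
  then obtain h where h: "\<And>x. (x, h x) \<in> K"
    by metis
  have uniq: "h x = r" if "(x, r) \<in> K" for x r
    using K(3)[OF Kdiff[OF h[of x] that]] by simp
  have "bounded_linear h"
  proof (rule bounded_linear_intro[where K = C])
    show "h (x + y) = h x + h y" for x y
      by (intro uniq Kadd h)
    show "h (c *\<^sub>R x) = c *\<^sub>R h x" for c x
      by (simp add: uniq Kscale h)
    show "norm (h x) \<le> norm x * C" for x
      using K(3)[OF h[of x]] by (simp add: mult.commute)
  qed
  with uniq K(2) show ?thesis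
    by (intro that) auto
qed

text \<open>
  The functional is extended through its real part. If \<open>h\<close> is a bounded real-linear functional
  extending the real part, then \<open>h x - h (j x) j\<close> is a homogeneous functional with real part
  \<open>h\<close>, and a homogeneous functional is determined by its real part. For \<open>j = 0\<close> the same formula
  is just \<open>h\<close>. The norm of the extension may grow, but boundedness is all that the applications
  require.
\<close>
lemma Hahn_Banach_graph:
  fixes smul :: "'k::real_or_complex \<Rightarrow> 'a::real_normed_vector \<Rightarrow> 'a" and G :: "('a \<times> 'k) set"
  assumes ns: "normed_space_over smul" and "0 \<le> C" and "G \<noteq> {}"
    and add: "\<And>x z y w. (x, z) \<in> G \<Longrightarrow> (y, w) \<in> G \<Longrightarrow> (x + y, z + w) \<in> G"
    and scale: "\<And>c x z. (x, z) \<in> G \<Longrightarrow> (smul c x, c * z) \<in> G"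
    and bound: "\<And>x z. (x, z) \<in> G \<Longrightarrow> norm z \<le> C * norm x"
  obtains F where "F \<in> dual_space smul" "\<And>x z. (x, z) \<in> G \<Longrightarrow> blinfun_apply F x = z"
proof -
  interpret V: module smul
    by (rule normed_space_over_module[OF ns])
  note of_real = normed_space_over_of_real[OF ns]
  obtain re im :: "'k \<Rightarrow> real" and j where re: "bounded_linear re" and re1: "re 1 = 1" "re j = 0"
    and rep: "\<And>z. z = re z *\<^sub>R 1 + im z *\<^sub>R j" and j: "j * j = -1 \<or> j = 0 \<and> (\<forall>z. im z = 0)"
    by (rule real_or_complex_coordinates) blast
  interpret re: bounded_linear re by fact
  obtain B where B: "0 \<le> B" "\<And>z. norm (re z) \<le> norm z * B"
    using re.nonneg_bounded by blast
  define R where "R = (\<lambda>(x, z). (x, re z)) ` G"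
  have inR: "(x, re z) \<in> R" if "(x, z) \<in> G" for x z
    using that by (force simp: R_def)
  have "subspace R"
    unfolding subspace_def
  proof (intro conjI ballI allI)
    obtain x z where "(x, z) \<in> G"
      using \<open>G \<noteq> {}\<close> by auto
    from inR[OF scale[OF this, of 0]] show "0 \<in> R"
      by (simp add: re.zero zero_prod_def)
    show "p + q \<in> R" if pq: "p \<in> R" "q \<in> R" for p q
    proof -
      obtain x z y w where *: "(x, z) \<in> G" "(y, w) \<in> G" "p = (x, re z)" "q = (y, re w)"
        using pq by (auto simp: R_def)
      show ?thesis
        using inR[OF add[OF *(1,2)]] * by (simp add: re.add)
    qed
    show "r *\<^sub>R p \<in> R" if p: "p \<in> R" for r p
    proof -
      obtain x z where *: "(x, z) \<in> G" "p = (x, re z)"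
        using p by (auto simp: R_def)
      have "of_real r * z = r *\<^sub>R z"
        by (simp add: scaleR_conv_of_real)
      then show ?thesis
        using inR[OF scale[OF *(1), of "of_real r"]] * by (simp add: re.scaleR of_real)
    qed
  qed
  moreover have "\<bar>r\<bar> \<le> (C * B) * norm x" if "(x, r) \<in> R" for x r
  proof -
    obtain z where z: "(x, z) \<in> G" "r = re z"
      using \<open>(x, r) \<in> R\<close> by (auto simp: R_def)
    have "\<bar>r\<bar> \<le> norm z * B"
      using B(2)[of z] z by simp
    also have "\<dots> \<le> (C * norm x) * B"
      using bound[OF z(1)] B(1) by (rule mult_right_mono)
    finally show ?thesis by (simp add: mult_ac)
  qed
  moreover have "0 \<le> C * B"
    using B \<open>0 \<le> C\<close> by simp
  ultimately obtain h where h: "bounded_linear h" "\<And>x r. (x, r) \<in> R \<Longrightarrow> h x = r"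
    using Hahn_Banach_real_graph[of "C * B" R] by blast
  interpret h: bounded_linear h by fact
  define F where "F = Blinfun (\<lambda>x. h x *\<^sub>R 1 - h (smul j x) *\<^sub>R j)"
  have F: "blinfun_apply F x = h x *\<^sub>R 1 - h (smul j x) *\<^sub>R j" for x
  proof -
    have "bounded_linear (\<lambda>x. h (smul j x))"
      using h(1) normed_space_over_bounded_linear[OF ns] by (rule bounded_linear_compose)
    then have "bounded_linear (\<lambda>x. h x *\<^sub>R 1 - h (smul j x) *\<^sub>R j)"
      using h(1) by (intro bounded_linear_sub bounded_linear_scaleR_const)
    then show ?thesis
      by (simp add: F_def bounded_linear_Blinfun_apply)
  qed
  have hom: "blinfun_apply F (smul c x) = c * blinfun_apply F x" for c x
  proof -
    define a b where "a = re c" and "b = im c"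
    have c: "c = of_real a + of_real b * j"
      using rep[of c] by (simp add: a_def b_def scaleR_conv_of_real)
    \<comment> \<open>This identity covers both fields: over the reals both sides vanish with \<open>b\<close>.\<close>
    have jj: "of_real b * (j * j) = - of_real b"
      using j by (auto simp: b_def)
    have c1: "smul c x = a *\<^sub>R x + b *\<^sub>R smul j x"
      by (simp add: c V.scale_left_distrib of_real flip: V.scale_scale)
    have "j * c = of_real a * j - of_real b"
      using jj by (simp add: c algebra_simps)
    then have "smul j (smul c x) = smul (of_real a * j) x - smul (of_real b) x"
      by (simp add: V.scale_left_diff_distrib)
    also have "smul (of_real a * j) x = smul (of_real a) (smul j x)"
      by simp
    finally have c2: "smul j (smul c x) = a *\<^sub>R smul j x - b *\<^sub>R x"
      by (simp only: of_real)
    define p q where "p = h x" and "q = h (smul j x)"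
    have "h (smul c x) = a * p + b * q" "h (smul j (smul c x)) = a * q - b * p"
      unfolding c2 unfolding c1 by (simp_all add: h.add h.diff h.scaleR p_def q_def)
    then have "blinfun_apply F (smul c x) = of_real (a * p + b * q) - of_real (a * q - b * p) * j"
      by (simp add: F scaleR_conv_of_real)
    also have "\<dots> = of_real a * of_real p - of_real a * of_real q * j + of_real b * of_real p * j
        - (of_real b * (j * j)) * of_real q"
      unfolding jj by (simp add: algebra_simps)
    also have "\<dots> = c * (of_real p - of_real q * j)"
      unfolding c by (simp add: algebra_simps)
    also have "\<dots> = c * blinfun_apply F x"
      by (simp add: F scaleR_conv_of_real p_def q_def)
    finally show ?thesis .
  qed
  then have "F \<in> dual_space smul"
    by (simp add: dual_space_def)
  moreover have "blinfun_apply F x = z" if "(x, z) \<in> G" for x z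
  proof (rule ccontr)
    assume ne: "blinfun_apply F x \<noteq> z"
    \<comment> \<open>This scalar turns a nonzero difference into one, whose real part is nonzero, while the
      real parts of the two functionals agree at every multiple of \<open>x\<close>.\<close>
    define c where "c = inverse (z - blinfun_apply F x)"
    have "re (blinfun_apply F (smul c x)) = h (smul c x)"
      by (simp add: F re.diff re.scaleR re1)
    also have "\<dots> = re (c * z)"
      using h(2) inR scale[OF that] by blast
    finally have "re (c * (z - blinfun_apply F x)) = 0"
      by (simp add: hom algebra_simps re.diff)
    moreover have "c * (z - blinfun_apply F x) = 1"
      using ne by (simp add: c_def)
    ultimately show False
      using re1 by simp
  qed
  ultimately show thesis by (rule that)
qed

section \<open>Open mappings and bounded projections\<close>

text \<open>
  The quantitative open mapping theorem: points of the closed image have preimages of comparable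
  norm. By Baire's theorem the closure of the image of some ball of \<open>S\<close> has interior in \<open>f ` S\<close>.
  Differences of points then show that every \<open>y\<close> in the image has an approximate preimage of
  norm at most \<open>K * norm y\<close> with error at most \<open>norm y / 2\<close>, and correcting the errors
  successively gives a geometric series that converges to an exact preimage.
\<close>
lemma open_mapping_constant:
  fixes f :: "'a::banach \<Rightarrow> 'b::banach"
  assumes f: "bounded_linear f" and S: "subspace S" "closed S" and clY: "closed (f ` S)"
  obtains C where "0 \<le> C" "\<And>y. y \<in> f ` S \<Longrightarrow> \<exists>x\<in>S. f x = y \<and> norm x \<le> C * norm y"
proof -
  interpret f: bounded_linear f by fact
  let ?Y = "f ` S"
  have subY: "subspace ?Y"
    using f.linear_axioms S(1) by (rule linear_subspace_image)
  define A where "A n = closure (f ` (S \<inter> cball 0 (real n)))" for n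
  have AY: "A n \<subseteq> ?Y" for n
    unfolding A_def using clY by (intro closure_minimal) auto
  have cover: "\<Union> (range A) = ?Y"
  proof
    show "?Y \<subseteq> \<Union> (range A)"
    proof
      fix y assume "y \<in> ?Y"
      then obtain x where x: "x \<in> S" "y = f x" by blast
      obtain n where "norm x \<le> real n"
        using real_arch_simple by blast
      then have "y \<in> A n"
        unfolding A_def using x by (intro closure_subset[THEN subsetD]) auto
      then show "y \<in> \<Union> (range A)" by blast
    qed
  qed (use AY in blast)
  have "\<exists>n. (top_of_set ?Y) interior_of (A n) \<noteq> {}"
  proof (rule ccontr)
    assume no_interior: "\<not> ?thesis"
    have "closedin (top_of_set ?Y) (A n)" for n
      using AY clY by (simp add: A_def closed_subset)
    moreover have "completely_metrizable_space (top_of_set ?Y)"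
      using completely_metrizable_space_closedin[OF completely_metrizable_space_euclidean] clY by simp
    ultimately have "(top_of_set ?Y) interior_of \<Union> (range A) = {}"
      using no_interior by (intro Baire_category_alt) auto
    then have "?Y = {}"
      unfolding cover using interior_of_topspace[of "top_of_set ?Y"] by simp
    then show False
      using subspace_0[OF subY] by blast
  qed
  then obtain n y0 where y0: "y0 \<in> (top_of_set ?Y) interior_of (A n)"
    by blast
  then obtain U where U: "open U" "y0 \<in> U" "y0 \<in> ?Y" "?Y \<inter> U \<subseteq> A n"
    by (auto simp: interior_of_def openin_open)
  then obtain e where e: "e > 0" "ball y0 e \<subseteq> U"
    by (auto simp: open_contains_ball)
  have near: "\<exists>x\<in>S. norm x \<le> 2 * real n \<and> norm (y - f x) < \<delta>"
    if y: "y \<in> ?Y" "norm y < e" and "\<delta> > 0" for y \<delta>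
  proof -
    have "y0 + y \<in> A n" "y0 \<in> A n"
      using U e y subspace_add[OF subY] by (auto simp: dist_norm subset_iff)
    then obtain x1 x0 where x: "x1 \<in> S" "norm x1 \<le> real n" "dist (f x1) (y0 + y) < \<delta> / 2"
      "x0 \<in> S" "norm x0 \<le> real n" "dist (f x0) y0 < \<delta> / 2"
      unfolding A_def closure_approachable using \<open>\<delta> > 0\<close>
      by (auto dest!: spec[of _ "\<delta> / 2"])
    have eq: "y - f (x1 - x0) = (f x0 - y0) - (f x1 - (y0 + y))"
      by (simp add: f.diff)
    then have "norm (y - f (x1 - x0)) < \<delta>"
      using x norm_triangle_ineq4[of "f x0 - y0" "f x1 - (y0 + y)"]
      unfolding eq dist_norm by linarith
    moreover have "norm (x1 - x0) \<le> 2 * real n"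
      using x norm_triangle_ineq4[of x1 x0] by simp
    ultimately show ?thesis
      using subspace_diff[OF S(1)] x by blast
  qed
  define K where "K = 4 * real n / e"
  have "0 \<le> K"
    using e by (simp add: K_def)
  have half: "\<exists>x\<in>S. norm x \<le> K * norm y \<and> norm (y - f x) \<le> norm y / 2" if y: "y \<in> ?Y" for y
  proof (cases "y = 0")
    case True
    then show ?thesis
      using subspace_0[OF S(1)] by (intro bexI[of _ 0]) (auto simp: f.zero)
  next
    case False
    \<comment> \<open>Scale \<open>y\<close> to norm \<open>e / 2\<close>, inside the ball where approximate preimages exist.\<close>
    define c where "c = e / (2 * norm y)"
    have "c > 0" "norm (c *\<^sub>R y) < e" "e / 4 > 0" and cy: "c *\<^sub>R y \<in> ?Y"
      using False e subspace_scale[OF subY y] by (auto simp: c_def)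
    then obtain x where x: "x \<in> S" "norm x \<le> 2 * real n" "norm (c *\<^sub>R y - f x) < e / 4"
      using near by blast
    have "norm (y - f (x /\<^sub>R c)) = norm (c *\<^sub>R y - f x) / c"
    proof -
      have "c *\<^sub>R (y - f (x /\<^sub>R c)) = c *\<^sub>R y - f x"
        using \<open>c > 0\<close> by (simp add: f.scaleR scaleR_diff_right)
      then have "c * norm (y - f (x /\<^sub>R c)) = norm (c *\<^sub>R y - f x)"
        using \<open>c > 0\<close> by (metis abs_of_pos norm_scaleR)
      then show ?thesis
        using \<open>c > 0\<close> by (simp add: field_simps)
    qed
    also have "\<dots> \<le> e / 4 / c"
      using x \<open>c > 0\<close> by (intro divide_right_mono) auto
    also have "\<dots> = norm y / 2"
      using e by (simp add: c_def)
    finally have "norm (y - f (x /\<^sub>R c)) \<le> norm y / 2" .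
    moreover have "norm (x /\<^sub>R c) \<le> K * norm y"
    proof -
      have "norm (x /\<^sub>R c) = norm x / c"
        using \<open>c > 0\<close> by (simp add: divide_inverse)
      also have "\<dots> \<le> 2 * real n / c"
        using x \<open>c > 0\<close> by (intro divide_right_mono) auto
      also have "\<dots> = K * norm y"
        by (simp add: c_def K_def)
      finally show ?thesis .
    qed
    ultimately show ?thesis
      using subspace_scale[OF S(1) x(1)] by blast
  qed
  then obtain g where g: "\<And>y. y \<in> ?Y \<Longrightarrow> g y \<in> S"
    "\<And>y. y \<in> ?Y \<Longrightarrow> norm (g y) \<le> K * norm y" "\<And>y. y \<in> ?Y \<Longrightarrow> norm (y - f (g y)) \<le> norm y / 2"
    by metis
  show thesis
  proof
    show "0 \<le> 2 * K" using \<open>0 \<le> K\<close> by simp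
    fix y assume y: "y \<in> ?Y"
    \<comment> \<open>The error that remains after \<open>n\<close> corrections.\<close>
    define r where "r n = ((\<lambda>y. y - f (g y)) ^^ n) y" for n
    have r0: "r 0 = y" and rS: "r (Suc n) = r n - f (g (r n))" for n
      by (auto simp: r_def)
    have rY: "r n \<in> ?Y" for n
      by (induction n) (use y g(1) subspace_diff[OF subY] in \<open>auto simp: r0 rS\<close>)
    have rb: "norm (r n) \<le> norm y * (1 / 2) ^ n" for n
    proof (induction n)
      case (Suc n)
      then show ?case
        using g(3)[OF rY[of n]] by (simp add: rS)
    qed (simp add: r0)
    have gb: "norm (g (r n)) \<le> (K * norm y) * (1 / 2) ^ n" for n
      using g(2)[OF rY[of n]] mult_left_mono[OF rb[of n] \<open>0 \<le> K\<close>] by (simp add: mult.assoc)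
    have geo: "(\<lambda>n. (K * norm y) * (1 / 2) ^ n) sums (K * norm y * 2)"
      using geometric_sums[of "1 / 2 :: real"] by (intro sums_mult) simp
    have sm: "summable (\<lambda>n. norm (g (r n)))"
      using gb geo by (intro summable_comparison_test[OF _ sums_summable[OF geo]]) auto
    define x where "x = (\<Sum>n. g (r n))"
    have sums: "(\<lambda>n. g (r n)) sums x"
      unfolding x_def by (intro summable_sums summable_norm_cancel[OF sm])
    have "x \<in> S"
    proof (rule closed_sequentially[OF S(2)])
      show "(\<Sum>k<n. g (r k)) \<in> S" for n
        using g(1) rY S(1) by (intro subspace_sum) auto
    qed (use sums in \<open>simp add: sums_def\<close>)
    moreover have "f x = y"
    proof (rule LIMSEQ_unique)
      show "(\<lambda>n. f (\<Sum>k<n. g (r k))) \<longlonglongrightarrow> f x"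
        using sums unfolding sums_def by (rule f.tendsto)
      have "f (\<Sum>k<n. g (r k)) = y - r n" for n
        by (induction n) (auto simp: r0 rS f.add f.zero)
      moreover have "r \<longlonglongrightarrow> 0"
      proof (rule Lim_null_comparison)
        show "(\<lambda>n. norm y * (1 / 2) ^ n) \<longlonglongrightarrow> 0"
          by (intro tendsto_mult_right_zero LIMSEQ_power_zero) simp
      qed (use rb in simp)
      ultimately show "(\<lambda>n. f (\<Sum>k<n. g (r k))) \<longlonglongrightarrow> y"
        using tendsto_diff[of "\<lambda>_. y" y sequentially r 0] by simp
    qed
    moreover have "norm x \<le> 2 * K * norm y"
    proof -
      have "norm x \<le> (\<Sum>n. norm (g (r n)))"
        unfolding x_def by (rule summable_norm[OF sm])
      also have "\<dots> \<le> (\<Sum>n. (K * norm y) * (1 / 2) ^ n)"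
        using gb sm sums_summable[OF geo] by (rule suminf_le)
      finally show ?thesis
        using sums_unique[OF geo] by (simp add: mult_ac)
    qed
    ultimately show "\<exists>x\<in>S. f x = y \<and> norm x \<le> 2 * K * norm y"
      by blast
  qed
qed

text \<open>
  Apply the open mapping theorem to the addition map on \<open>M \<times> N\<close>. It is injective because
  \<open>M \<inter> N = {0}\<close>, so the controlled preimage of \<open>x + y\<close> can only be \<open>(x, y)\<close>.
\<close>
lemma bounded_projection:
  fixes M N :: "'b::banach set"
  assumes M: "subspace M" "closed M" and N: "subspace N" "closed N"
    and "closed {x + y | x y. x \<in> M \<and> y \<in> N}" and int: "M \<inter> N = {0}"
  obtains P C where "\<And>x y. x \<in> M \<Longrightarrow> y \<in> N \<Longrightarrow> P (x + y) = x"
    "\<And>x y. x \<in> M \<Longrightarrow> y \<in> N \<Longrightarrow> norm x \<le> C * norm (x + y)"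
proof -
  have uniq: "x = x'" "y = y'" if "x + y = x' + y'" "x \<in> M" "x' \<in> M" "y \<in> N" "y' \<in> N" for x x' y y'
  proof -
    have eq: "x - x' = y' - y"
      using that(1) by (simp add: algebra_simps)
    have "x - x' \<in> M" "y' - y \<in> N"
      using that subspace_diff M(1) N(1) by blast+
    then have "x - x' \<in> M \<inter> N"
      by (simp only: eq Int_iff)
    then have "x - x' = 0"
      unfolding int by simp
    moreover from this have "y' - y = 0"
      unfolding eq .
    ultimately show "x = x'" "y = y'"
      by simp_all
  qed
  let ?f = "\<lambda>p :: 'b \<times> 'b. fst p + snd p"
  have img: "?f ` (M \<times> N) = {x + y | x y. x \<in> M \<and> y \<in> N}"
    by force
  have "bounded_linear ?f"
    by (intro bounded_linear_add bounded_linear_fst bounded_linear_snd)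
  then obtain C where C: "0 \<le> C"
    "\<And>y. y \<in> ?f ` (M \<times> N) \<Longrightarrow> \<exists>p\<in>M \<times> N. ?f p = y \<and> norm p \<le> C * norm y"
    using assms by (elim open_mapping_constant[of ?f "M \<times> N"])
      (auto simp: img intro: subspace_Times closed_Times)
  show thesis
  proof (rule that)
    fix x y assume xy: "x \<in> M" "y \<in> N"
    show "(THE u. u \<in> M \<and> (\<exists>v\<in>N. x + y = u + v)) = x"
      using xy uniq(1) by (intro the_equality) blast+
    have "x + y \<in> ?f ` (M \<times> N)"
      using xy by (auto simp: img)
    from C(2)[OF this] obtain p where "p \<in> M \<times> N" "?f p = x + y" "norm p \<le> C * norm (x + y)"
      by blast
    moreover from this have "fst p = x"
      using xy by (intro uniq(1)[of "fst p" "snd p" x y]) auto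
    ultimately show "norm x \<le> C * norm (x + y)"
      using norm_fst_le[of x y] by (cases p) auto
  qed
qed

lemma dual_scale_of_real: "dual_scale (of_real r) f = r *\<^sub>R f"
  by (rule blinfun_eqI) (simp add: scaleR_conv_of_real blinfun.scaleR_left)

lemma module_dual_scale: "module dual_scale"
  by standard (auto intro!: blinfun_eqI simp: blinfun.add_left blinfun.add_right algebra_simps)

lemma closed_subspace_of_iff:
  assumes "module smul"
  shows "closed_subspace_of smul V M \<longleftrightarrow>
    M \<subseteq> V \<and> closed M \<and> 0 \<in> M \<and> (\<forall>x\<in>M. \<forall>y\<in>M. x + y \<in> M) \<and> (\<forall>c. \<forall>x\<in>M. smul c x \<in> M)"
  unfolding closed_subspace_of_def module.subspace_def[OF assms] by auto

lemma real_subspace_if_closed_subspace_of: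
  assumes mod: "module smul" and of_real: "\<And>r x. smul (of_real r) x = r *\<^sub>R x"
    and M: "closed_subspace_of smul V M"
  shows "subspace M"
  using M unfolding closed_subspace_of_iff[OF mod] subspace_def of_real[symmetric] by blast

text \<open>
  The bounded projection of \<open>V\<close> onto \<open>M\<close> along \<open>N\<close>, homogeneous over the scalar field. The
  lemma is used both with \<open>V\<close> the whole space and with \<open>V\<close> the dual inside the type of bounded
  real-linear maps, so \<open>V\<close> is a set and the properties are relative to it.
\<close>
lemma complement_projection:
  fixes smul :: "'k::real_or_complex \<Rightarrow> 'b::banach \<Rightarrow> 'b"
  assumes mod: "module smul" and of_real: "\<And>r x. smul (of_real r) x = r *\<^sub>R x"
    and "closed V" and M: "closed_subspace_of smul V M" and N: "closed_subspace_of smul V N"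
    and sum: "{x + y | x y. x \<in> M \<and> y \<in> N} = V" and int: "M \<inter> N = {0}"
  obtains P C where "\<And>x. x \<in> V \<Longrightarrow> P x \<in> M" "\<And>x. x \<in> V \<Longrightarrow> x - P x \<in> N"
    "\<And>x. x \<in> M \<Longrightarrow> P x = x" "\<And>y. y \<in> N \<Longrightarrow> P y = 0"
    "\<And>x y. x \<in> V \<Longrightarrow> y \<in> V \<Longrightarrow> P (x + y) = P x + P y"
    "\<And>c x. x \<in> V \<Longrightarrow> P (smul c x) = smul c (P x)"
    "\<And>x. x \<in> V \<Longrightarrow> norm (P x) \<le> C * norm x"
proof -
  note iff = closed_subspace_of_iff[OF mod]
  note real = real_subspace_if_closed_subspace_of[OF mod of_real]
  obtain P C where P: "\<And>x y. x \<in> M \<Longrightarrow> y \<in> N \<Longrightarrow> P (x + y) = x"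
    and C: "\<And>x y. x \<in> M \<Longrightarrow> y \<in> N \<Longrightarrow> norm x \<le> C * norm (x + y)"
  proof (rule bounded_projection[of M N])
    show "closed {x + y | x y. x \<in> M \<and> y \<in> N}"
      unfolding sum by fact
  qed (use M N int real[OF M] real[OF N] in \<open>auto simp: closed_subspace_of_def\<close>)
  have decomp: "\<exists>x\<in>M. \<exists>y\<in>N. z = x + y" if "z \<in> V" for z
    using sum that by blast
  show thesis
  proof
    fix z w assume z: "z \<in> V" and w: "w \<in> V"
    obtain x y where xy: "x \<in> M" "y \<in> N" "z = x + y"
      using decomp[OF z] by blast
    then have Pz: "P z = x"
      using P by blast
    show "P z \<in> M" "z - P z \<in> N" "norm (P z) \<le> C * norm z"
      using xy C unfolding Pz by auto
    obtain x' y' where xy': "x' \<in> M" "y' \<in> N" "w = x' + y'"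
      using decomp[OF w] by blast
    then have Pw: "P w = x'"
      using P by blast
    have "z + w = (x + x') + (y + y')"
      by (simp add: xy xy')
    also have "P \<dots> = x + x'"
      using xy xy' M N by (intro P) (auto simp: iff)
    finally show "P (z + w) = P z + P w"
      unfolding Pz Pw .
    show "P (smul c z) = smul c (P z)" for c
    proof -
      have "smul c z = smul c x + smul c y"
        by (simp add: xy module.scale_right_distrib[OF mod])
      also have "P \<dots> = smul c x"
        using xy M N by (intro P) (auto simp: iff)
      finally show ?thesis
        unfolding Pz .
    qed
  next
    show "P x = x" if "x \<in> M" for x
      using P[OF that, of 0] N by (auto simp: iff)
    show "P y = 0" if "y \<in> N" for y
      using P[of 0 y] that M by (auto simp: iff)
  qed
qed

section \<open>Annihilators\<close>

definition annihilator ::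
    "('k::real_or_complex \<Rightarrow> 'a::real_normed_vector \<Rightarrow> 'a) \<Rightarrow> 'a set \<Rightarrow> ('a \<Rightarrow>\<^sub>L 'k) set" where
  "annihilator smul M = {f \<in> dual_space smul. \<forall>x\<in>M. blinfun_apply f x = 0}"

definition preannihilator :: "('a::real_normed_vector \<Rightarrow>\<^sub>L 'k::real_or_complex) set \<Rightarrow> 'a set" where
  "preannihilator V = {x. \<forall>f\<in>V. blinfun_apply f x = 0}"

lemma closed_subspace_annihilator:
  "closed_subspace_of dual_scale (dual_space smul) (annihilator smul M)"
proof -
  have "annihilator smul M = dual_space smul \<inter> (\<Inter>x\<in>M. {f. blinfun_apply f x = 0})"
    by (auto simp: annihilator_def)
  also have "closed \<dots>"
    by (intro closed_Int closed_dual_space closed_INT ballI closed_Collect_eq continuous_intros)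
  finally show ?thesis
    by (auto simp: closed_subspace_of_iff[OF module_dual_scale] annihilator_def dual_space_def
        blinfun.add_left algebra_simps)
qed

lemma closed_subspace_preannihilator:
  assumes "normed_space_over smul" "V \<subseteq> dual_space smul"
  shows "closed_subspace_of smul UNIV (preannihilator V)"
proof -
  have "preannihilator V = (\<Inter>f\<in>V. {x. blinfun_apply f x = 0})"
    by (auto simp: preannihilator_def)
  also have "closed \<dots>"
    by (intro closed_INT ballI closed_Collect_eq continuous_intros)
  finally show ?thesis
    using assms(2)
    by (auto simp: closed_subspace_of_iff[OF normed_space_over_module[OF assms(1)]]
        preannihilator_def dual_space_def blinfun.add_right subset_iff)
qed

lemma closed_subspace_closure:
  assumes ns: "normed_space_over smul" and "module.subspace smul M"
  shows "closed_subspace_of smul UNIV (closure M)"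
proof -
  note sub = module.subspace_def[OF normed_space_over_module[OF ns], THEN iffD1, OF assms(2)]
  have "x + y \<in> closure M" if xy: "x \<in> closure M" "y \<in> closure M" for x y
  proof -
    obtain u v where "\<forall>n. u n \<in> M" "u \<longlonglongrightarrow> x" "\<forall>n. v n \<in> M" "v \<longlonglongrightarrow> y"
      using xy by (auto simp: closure_sequential)
    then show ?thesis
      unfolding closure_sequential using sub by (intro exI[of _ "\<lambda>n. u n + v n"]) (auto intro: tendsto_add)
  qed
  moreover have "smul c x \<in> closure M" if x: "x \<in> closure M" for c x
  proof -
    obtain u where "\<forall>n. u n \<in> M" "u \<longlonglongrightarrow> x"
      using x by (auto simp: closure_sequential)
    then show ?thesis
      unfolding closure_sequential using sub normed_space_over_bounded_linear[OF ns, of c]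
      by (intro exI[of _ "\<lambda>n. smul c (u n)"]) (auto intro: bounded_linear.tendsto)
  qed
  moreover have "0 \<in> closure M"
    using sub closure_subset by blast
  ultimately show ?thesis
    by (simp add: closed_subspace_of_iff[OF normed_space_over_module[OF ns]])
qed

lemma annihilator_closure: "annihilator smul (closure M) = annihilator smul M"
proof -
  have "blinfun_apply f x = 0" if f: "\<forall>x\<in>M. blinfun_apply f x = 0" and "x \<in> closure M" for f x
  proof -
    have "closure M \<subseteq> {x. blinfun_apply f x = 0}"
      using f by (intro closure_minimal closed_Collect_eq continuous_intros) auto
    then show ?thesis using that by blast
  qed
  then show ?thesis
    using closure_subset[of M] by (auto simp: annihilator_def)
qed

lemma preannihilator_closure: "preannihilator (closure V) = preannihilator V"
proof -
  have "blinfun_apply f x = 0" if x: "\<forall>f\<in>V. blinfun_apply f x = 0" and "f \<in> closure V" for f x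
  proof -
    have "closure V \<subseteq> {f. blinfun_apply f x = 0}"
      using x by (intro closure_minimal closed_Collect_eq continuous_intros) auto
    then show ?thesis using that by blast
  qed
  then show ?thesis
    using closure_subset[of V] by (auto simp: preannihilator_def)
qed

text \<open>
  The functional \<open>m + c x0 \<mapsto> c\<close> on the span of \<open>M\<close> and \<open>x0\<close> is bounded by the inverse of the
  distance from \<open>x0\<close> to \<open>M\<close>, which is positive since \<open>M\<close> is closed; extend it.
\<close>
lemma separating_functional:
  assumes ns: "normed_space_over smul" and M: "closed_subspace_of smul UNIV M" and "x0 \<notin> M"
  obtains F where "F \<in> annihilator smul M" "blinfun_apply F x0 = 1"
proof -
  interpret V: module smul
    by (rule normed_space_over_module[OF ns])
  have M': "closed M" "0 \<in> M" "\<And>x y. x \<in> M \<Longrightarrow> y \<in> M \<Longrightarrow> x + y \<in> M" "\<And>c x. x \<in> M \<Longrightarrow> smul c x \<in> M"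
    using M by (auto simp: closed_subspace_of_iff[OF V.module_axioms])
  obtain d where "d > 0" "ball x0 d \<subseteq> - M"
    using M'(1) \<open>x0 \<notin> M\<close> by (metis ComplI open_Compl open_contains_ball)
  then have d: "d > 0" "\<And>y. y \<in> M \<Longrightarrow> d \<le> dist x0 y"
    by (meson ComplD mem_ball not_le subsetD)+
  define G where "G = {(m + smul c x0, c) | m c. m \<in> M}"
  have GI: "(x, c) \<in> G \<longleftrightarrow> (\<exists>m\<in>M. x = m + smul c x0)" for x c
    by (auto simp: G_def)
  have bound: "norm c \<le> (1 / d) * norm x" if xc: "(x, c) \<in> G" for x c
  proof (cases "c = 0")
    case False
    obtain m where m: "m \<in> M" "x = m + smul c x0"
      using xc GI by blast
    have "d \<le> norm (x0 + smul (inverse c) m)"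
      using d(2)[OF M'(4)[OF m(1), of "- inverse c"]] by (simp add: dist_norm)
    also have "x0 + smul (inverse c) m = smul (inverse c) x"
      using False by (simp add: m V.scale_right_distrib)
    finally have "d \<le> norm x / norm c"
      by (simp add: normed_space_over_norm[OF ns] norm_inverse divide_inverse mult.commute)
    then show ?thesis
      using False d(1) by (simp add: field_simps)
  qed (use d in auto)
  have "G \<noteq> {}"
    using M'(2) by (auto simp: G_def)
  moreover have "(x + y, c + b) \<in> G" if xy: "(x, c) \<in> G" "(y, b) \<in> G" for x y c b
  proof -
    obtain m n where "m \<in> M" "n \<in> M" "x = m + smul c x0" "y = n + smul b x0"
      using xy GI by blast
    then show ?thesis
      unfolding GI using M'(3) by (intro bexI[of _ "m + n"]) (auto simp: V.scale_left_distrib)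
  qed
  moreover have "(smul b x, b * c) \<in> G" if xc: "(x, c) \<in> G" for x c b
  proof -
    obtain m where "m \<in> M" "x = m + smul c x0"
      using xc GI by blast
    then show ?thesis
      unfolding GI using M'(4) by (intro bexI[of _ "smul b m"]) (auto simp: V.scale_right_distrib)
  qed
  moreover have "0 \<le> 1 / d"
    using d by simp
  ultimately obtain F where F: "F \<in> dual_space smul" "\<And>x c. (x, c) \<in> G \<Longrightarrow> blinfun_apply F x = c"
    using Hahn_Banach_graph[OF ns, of "1 / d" G] bound by blast
  show thesis
  proof
    have "(m, 0) \<in> G" if "m \<in> M" for m
      unfolding GI using that by (intro bexI[of _ m]) auto
    then show "F \<in> annihilator smul M"
      using F by (auto simp: annihilator_def)
    have "(x0, 1) \<in> G"
      unfolding GI using M'(2) by (intro bexI[of _ 0]) auto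
    then show "blinfun_apply F x0 = 1"
      by (rule F(2))
  qed
qed

text \<open>
  The bipolar theorem for closed subspaces: a point outside \<open>M\<close> is detected by a functional
  that vanishes on \<open>M\<close>.
\<close>
lemma preannihilator_annihilator:
  assumes "normed_space_over smul" "closed_subspace_of smul UNIV M"
  shows "preannihilator (annihilator smul M) = M"
proof
  show "preannihilator (annihilator smul M) \<subseteq> M"
  proof
    fix x assume "x \<in> preannihilator (annihilator smul M)"
    then show "x \<in> M"
      using separating_functional[OF assms] by (force simp: preannihilator_def)
  qed
qed (auto simp: preannihilator_def annihilator_def)

lemma dual_space_separates_points:
  assumes ns: "normed_space_over smul" and "\<And>f. f \<in> dual_space smul \<Longrightarrow> blinfun_apply f x = 0"
  shows "x = 0"
proof -
  have "closed_subspace_of smul UNIV {0}"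
    using normed_space_over_module[OF ns]
    by (auto simp: closed_subspace_of_iff module.scale_zero_right)
  from preannihilator_annihilator[OF ns this] show ?thesis
    using assms(2) by (auto simp: preannihilator_def annihilator_def)
qed

section \<open>Complements of annihilators\<close>

text \<open>
  If \<open>N\<close> is a complement of \<open>M\<close> and \<open>P\<close> the bounded projection onto \<open>M\<close> along \<open>N\<close>, then
  \<open>f = f \<circ> (1 - P) + f \<circ> P\<close> splits every functional into one that vanishes on \<open>M\<close> and one that
  vanishes on \<open>N\<close>. Boundedness of \<open>P\<close> is what keeps the two summands in the dual.
\<close>
lemma complemented_annihilator:
  fixes smul :: "'k::real_or_complex \<Rightarrow> 'a::banach \<Rightarrow> 'a"
  assumes ns: "normed_space_over smul" and "complemented_in smul UNIV M"
  shows "complemented_in dual_scale (dual_space smul) (annihilator smul M)"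
proof -
  note mod = normed_space_over_module[OF ns] and of_real = normed_space_over_of_real[OF ns]
  obtain N where M: "closed_subspace_of smul UNIV M" and N: "closed_subspace_of smul UNIV N"
    and sum: "{x + y | x y. x \<in> M \<and> y \<in> N} = UNIV" and int: "M \<inter> N = {0}"
    using assms(2) by (auto simp: complemented_in_def)
  obtain P C where P: "\<And>x. P x \<in> M" "\<And>x. x - P x \<in> N" "\<And>x. x \<in> M \<Longrightarrow> P x = x" "\<And>y. y \<in> N \<Longrightarrow> P y = 0"
    "\<And>x y. P (x + y) = P x + P y" "\<And>c x. P (smul c x) = smul c (P x)" "\<And>x. norm (P x) \<le> C * norm x"
    by (rule complement_projection[OF mod of_real closed_UNIV M N sum int]) (rule that, use UNIV_I in \<open>blast+\<close>)
  have "bounded_linear P"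
  proof (rule bounded_linear_intro[where K = C])
    show "P (r *\<^sub>R x) = r *\<^sub>R P x" for r x
      using P(6)[of "of_real r" x] by (simp add: of_real)
  qed (use P in \<open>simp_all add: mult.commute\<close>)
  then have P_apply: "blinfun_apply (Blinfun P) = P"
    by (rule bounded_linear_Blinfun_apply)
  have "f \<in> {g + h | g h. g \<in> annihilator smul M \<and> h \<in> annihilator smul N}"
    if f: "f \<in> dual_space smul" for f
  proof -
    define h where "h = f o\<^sub>L Blinfun P"
    have "h \<in> annihilator smul N" "f - h \<in> annihilator smul M"
      using f by (auto simp: h_def annihilator_def dual_space_def P_apply P blinfun.zero_right
          blinfun.diff_left algebra_simps)
    moreover have "f = (f - h) + h"
      by simp
    ultimately show ?thesis by blast
  qed
  moreover have "g + h \<in> dual_space smul" if "g \<in> annihilator smul M" "h \<in> annihilator smul N" for g h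
    using that by (auto simp: annihilator_def dual_space_def blinfun.add_left algebra_simps)
  ultimately have "{g + h | g h. g \<in> annihilator smul M \<and> h \<in> annihilator smul N} = dual_space smul"
    by blast
  moreover have "annihilator smul M \<inter> annihilator smul N = {0}"
  proof -
    have "f = 0" if "f \<in> annihilator smul M" "f \<in> annihilator smul N" for f
    proof (rule blinfun_eqI)
      fix z
      have "blinfun_apply f (P z) + blinfun_apply f (z - P z) = 0"
        using that P(1,2) by (simp add: annihilator_def)
      then show "blinfun_apply f z = blinfun_apply 0 z"
        by (simp flip: blinfun.add_right)
    qed
    moreover have "0 \<in> annihilator smul M" "0 \<in> annihilator smul N"
      by (auto simp: annihilator_def dual_space_def)
    ultimately show ?thesis by blast
  qed
  ultimately show ?thesis
    unfolding complemented_in_def using closed_subspace_annihilator by blast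
qed

text \<open>
  The converse passage, from the dual back to the space, costs reflexivity. Let \<open>Q\<close> be the
  bounded projection of the dual onto \<open>V\<close> along a complement \<open>W\<close>. For a point \<open>z\<close> the map
  \<open>f \<mapsto> (Q f) z\<close> belongs to the bidual, hence is evaluation at some point \<open>y\<close>. This \<open>y\<close> is
  annihilated by \<open>W\<close>, on which \<open>Q\<close> vanishes, and \<open>z - y\<close> is annihilated by \<open>V\<close>, which \<open>Q\<close> fixes.
\<close>
lemma complemented_preannihilator:
  fixes smul :: "'k::real_or_complex \<Rightarrow> 'a::real_normed_vector \<Rightarrow> 'a"
  assumes ns: "normed_space_over smul" and refl: "reflexive_space smul"
    and "complemented_in dual_scale (dual_space smul) V"
  shows "complemented_in smul UNIV (preannihilator V)"
proof -
  obtain W where V: "closed_subspace_of dual_scale (dual_space smul) V"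
    and W: "closed_subspace_of dual_scale (dual_space smul) W"
    and sum: "{f + g | f g. f \<in> V \<and> g \<in> W} = dual_space smul" and int: "V \<inter> W = {0}"
    using assms(3) by (auto simp: complemented_in_def)
  have sub: "V \<subseteq> dual_space smul" "W \<subseteq> dual_space smul"
    using V W by (auto simp: closed_subspace_of_def)
  obtain Q C where Q: "\<And>f. f \<in> dual_space smul \<Longrightarrow> Q f \<in> V" "\<And>f. f \<in> dual_space smul \<Longrightarrow> f - Q f \<in> W"
    "\<And>f. f \<in> V \<Longrightarrow> Q f = f" "\<And>g. g \<in> W \<Longrightarrow> Q g = 0"
    "\<And>f g. f \<in> dual_space smul \<Longrightarrow> g \<in> dual_space smul \<Longrightarrow> Q (f + g) = Q f + Q g"
    "\<And>c f. f \<in> dual_space smul \<Longrightarrow> Q (dual_scale c f) = dual_scale c (Q f)"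
    "\<And>f. f \<in> dual_space smul \<Longrightarrow> norm (Q f) \<le> C * norm f"
    using complement_projection[OF module_dual_scale dual_scale_of_real closed_dual_space V W sum int]
    by blast
  have "\<exists>x y. x \<in> preannihilator V \<and> y \<in> preannihilator W \<and> z = x + y" for z
  proof -
    have "norm (blinfun_apply (Q f) z) \<le> (C * norm z) * norm f" if f: "f \<in> dual_space smul" for f
    proof -
      have "norm (blinfun_apply (Q f) z) \<le> norm (Q f) * norm z"
        by (rule norm_blinfun)
      also have "\<dots> \<le> (C * norm f) * norm z"
        using Q(7)[OF f] by (intro mult_right_mono) auto
      finally show ?thesis by (simp add: mult_ac)
    qed
    then have "(\<lambda>f. blinfun_apply (Q f) z) \<in> bidual smul"
      by (auto simp: bidual_def Q blinfun.add_left)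
    from bspec[OF refl[unfolded reflexive_space_def] this] obtain y
      where y: "\<And>f. f \<in> dual_space smul \<Longrightarrow> blinfun_apply (Q f) z = blinfun_apply f y"
      by (elim exE) (simp only: Ball_def)
    have "blinfun_apply g y = 0" if "g \<in> W" for g
      using y[of g] Q(4)[OF that] sub that by auto
    then have "y \<in> preannihilator W"
      by (simp add: preannihilator_def)
    moreover have "blinfun_apply f (z - y) = 0" if "f \<in> V" for f
      using y[of f] Q(3)[OF that] sub that by (auto simp: blinfun.diff_right)
    then have "z - y \<in> preannihilator V"
      by (simp add: preannihilator_def)
    moreover have "z = (z - y) + y"
      by simp
    ultimately show ?thesis by blast
  qed
  then have "{x + y | x y. x \<in> preannihilator V \<and> y \<in> preannihilator W} = UNIV"
    by blast
  moreover have "preannihilator V \<inter> preannihilator W = {0}"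
  proof -
    have "x = 0" if x: "x \<in> preannihilator V" "x \<in> preannihilator W" for x
    proof (rule dual_space_separates_points[OF ns])
      fix f assume "f \<in> dual_space smul"
      then have "blinfun_apply (Q f) x = 0" "blinfun_apply (f - Q f) x = 0"
        using Q(1,2) x by (auto simp: preannihilator_def)
      then show "blinfun_apply f x = 0"
        by (simp add: blinfun.diff_left)
    qed
    then show ?thesis
      by (auto simp: preannihilator_def)
  qed
  ultimately show ?thesis
    unfolding complemented_in_def
    by (intro conjI exI[of _ "preannihilator W"] closed_subspace_preannihilator[OF ns] sub)
qed

section \<open>Kernels and ranges of an operator and its adjoint\<close>

lemma annihilator_range:
  "annihilator smul (range (blinfun_apply T)) = {f \<in> dual_space smul. normed_adjoint T f = 0}"
proof -
  have "normed_adjoint T f = 0 \<longleftrightarrow> (\<forall>x. blinfun_apply f (blinfun_apply T x) = 0)" for f :: "'a \<Rightarrow>\<^sub>L 'b"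
  proof
    assume "normed_adjoint T f = 0"
    then have "blinfun_apply (normed_adjoint T f) x = 0" for x
      by simp
    then show "\<forall>x. blinfun_apply f (blinfun_apply T x) = 0"
      by (simp add: normed_adjoint_def)
  qed (auto simp: normed_adjoint_def intro: blinfun_eqI)
  then show ?thesis
    by (auto simp: annihilator_def)
qed

text \<open>
  \<open>f (T x) = 0\<close> for every functional \<open>f\<close> forces \<open>T x = 0\<close>, since functionals separate points.
\<close>
lemma preannihilator_range_adjoint:
  fixes T :: "'a::real_normed_vector \<Rightarrow>\<^sub>L 'a" and smul :: "'k::real_or_complex \<Rightarrow> 'a \<Rightarrow> 'a"
  assumes "normed_space_over smul"
  shows "preannihilator (normed_adjoint T ` dual_space smul) = {x. blinfun_apply T x = 0}"
proof -
  have "blinfun_apply T x = 0 \<longleftrightarrow> (\<forall>f\<in>dual_space smul. blinfun_apply f (blinfun_apply T x) = 0)" for x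
    using dual_space_separates_points[OF assms, of "blinfun_apply T x"] by (auto simp: blinfun.zero_right)
  then show ?thesis
    by (simp add: preannihilator_def normed_adjoint_def)
qed

text \<open>
  The part of the closed range theorem that is used here. A functional \<open>f\<close> vanishing on the
  kernel factors through the range as \<open>T x \<mapsto> f x\<close>; the open mapping theorem bounds this
  factorization because the range is closed, and its extension to the whole space is a preimage
  of \<open>f\<close> under the adjoint.
\<close>
lemma range_adjoint_eq_annihilator_kernel:
  fixes smul :: "'k::real_or_complex \<Rightarrow> 'a::banach \<Rightarrow> 'a"
  assumes ns: "normed_space_over smul" and T: "T \<in> bounded_operators smul"
    and cl: "closed (range (blinfun_apply T))"
  shows "normed_adjoint T ` dual_space smul = annihilator smul {x. blinfun_apply T x = 0}"
proof
  show "normed_adjoint T ` dual_space smul \<subseteq> annihilator smul {x. blinfun_apply T x = 0}"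
    using normed_adjoint_in_dual_space[OF T] by (auto simp: annihilator_def normed_adjoint_def)
  show "annihilator smul {x. blinfun_apply T x = 0} \<subseteq> normed_adjoint T ` dual_space smul"
  proof
    fix f :: "'a \<Rightarrow>\<^sub>L 'k" assume f: "f \<in> annihilator smul {x. blinfun_apply T x = 0}"
    obtain C where C: "0 \<le> C"
      "\<And>y. y \<in> range (blinfun_apply T) \<Longrightarrow> \<exists>x\<in>UNIV. blinfun_apply T x = y \<and> norm x \<le> C * norm y"
      using open_mapping_constant[OF blinfun.bounded_linear_right subspace_UNIV closed_UNIV cl] by blast
    define G where "G = range (\<lambda>x. (blinfun_apply T x, blinfun_apply f x))"
    have "G \<noteq> {}"
      by (simp add: G_def)
    moreover have "(x + y, z + w) \<in> G" if "(x, z) \<in> G" "(y, w) \<in> G" for x y z w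
      using that by (auto simp: G_def simp flip: blinfun.add_right)
    moreover have "(smul c x, c * z) \<in> G" if "(x, z) \<in> G" for c x z
    proof -
      obtain u where "x = blinfun_apply T u" "z = blinfun_apply f u"
        using \<open>(x, z) \<in> G\<close> by (auto simp: G_def)
      then have "smul c x = blinfun_apply T (smul c u)" "c * z = blinfun_apply f (smul c u)"
        using T f by (auto simp: bounded_operators_def annihilator_def dual_space_def)
      then show ?thesis
        by (auto simp: G_def)
    qed
    moreover have "norm z \<le> (norm f * C) * norm y" if "(y, z) \<in> G" for y z
    proof -
      obtain u where u: "y = blinfun_apply T u" "z = blinfun_apply f u"
        using \<open>(y, z) \<in> G\<close> by (auto simp: G_def)
      obtain x where x: "blinfun_apply T x = y" "norm x \<le> C * norm y"
        using C(2)[of y] u by auto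
      have "blinfun_apply T (u - x) = 0"
        using x u by (simp add: blinfun.diff_right)
      then have "blinfun_apply f (u - x) = 0"
        using f by (simp add: annihilator_def)
      then have "norm z = norm (blinfun_apply f x)"
        using u by (simp add: blinfun.diff_right)
      also have "\<dots> \<le> norm f * norm x"
        by (rule norm_blinfun)
      also have "\<dots> \<le> norm f * (C * norm y)"
        using x by (intro mult_left_mono) auto
      finally show ?thesis by (simp add: mult_ac)
    qed
    moreover have "0 \<le> norm f * C"
      using C by simp
    ultimately obtain g where g: "g \<in> dual_space smul" "\<And>y z. (y, z) \<in> G \<Longrightarrow> blinfun_apply g y = z"
      using Hahn_Banach_graph[OF ns, of "norm f * C" G] by blast
    have "normed_adjoint T g = f"
      by (rule blinfun_eqI) (simp add: normed_adjoint_def g(2) G_def)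
    then show "f \<in> normed_adjoint T ` dual_space smul"
      using g(1) by blast
  qed
qed

theorem theorem3p1:
  fixes smul :: "'k::real_or_complex \<Rightarrow> 'a::banach \<Rightarrow> 'a"
    and T :: "'a \<Rightarrow>\<^sub>L 'a"
  assumes "normed_space_over smul"
    and "T \<in> bounded_operators smul"
  shows
    "(complemented_in smul UNIV (closure (range (blinfun_apply T))) \<longrightarrow>
        complemented_in dual_scale (dual_space smul) {f \<in> dual_space smul. normed_adjoint T f = 0}) \<and>
     (reflexive_space smul \<and>
      complemented_in dual_scale (dual_space smul) {f \<in> dual_space smul. normed_adjoint T f = 0} \<longrightarrow>
        complemented_in smul UNIV (closure (range (blinfun_apply T)))) \<and>
     (reflexive_space smul \<and>
      complemented_in dual_scale (dual_space smul) (closure (normed_adjoint T ` dual_space smul)) \<longrightarrow>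
        complemented_in smul UNIV {x. blinfun_apply T x = 0}) \<and>
     (closed (range (blinfun_apply T)) \<and> complemented_in smul UNIV {x. blinfun_apply T x = 0} \<longrightarrow>
        closed (normed_adjoint T ` dual_space smul) \<and>
        complemented_in dual_scale (dual_space smul) (normed_adjoint T ` dual_space smul))"
proof -
  let ?R = "closure (range (blinfun_apply T))"
  have kernel_adjoint: "{f \<in> dual_space smul. normed_adjoint T f = 0} = annihilator smul ?R"
    unfolding annihilator_closure by (simp add: annihilator_range)
  have "module.subspace smul (range (blinfun_apply T))"
    unfolding module.subspace_def[OF normed_space_over_module[OF assms(1)]]
  proof (intro conjI ballI allI)
    show "0 \<in> range (blinfun_apply T)"
      by (rule range_eqI[of _ _ 0]) simp
    show "x + y \<in> range (blinfun_apply T)" if "x \<in> range (blinfun_apply T)" "y \<in> range (blinfun_apply T)" for x y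
      using that by (auto simp flip: blinfun.add_right)
    show "smul c x \<in> range (blinfun_apply T)" if x: "x \<in> range (blinfun_apply T)" for c x
    proof -
      obtain u where "x = blinfun_apply T u"
        using x by blast
      then have "smul c x = blinfun_apply T (smul c u)"
        using assms(2) by (simp add: bounded_operators_def)
      then show ?thesis by blast
    qed
  qed
  then have closed_range: "preannihilator (annihilator smul ?R) = ?R"
    using assms(1) by (intro preannihilator_annihilator closed_subspace_closure)
  have kernel: "preannihilator (closure (normed_adjoint T ` dual_space smul)) = {x. blinfun_apply T x = 0}"
    unfolding preannihilator_closure by (rule preannihilator_range_adjoint[OF assms(1)])
  show ?thesis
  proof (intro conjI impI; (elim conjE)?)
    assume "complemented_in smul UNIV ?R"
    then show "complemented_in dual_scale (dual_space smul) {f \<in> dual_space smul. normed_adjoint T f = 0}"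
      unfolding kernel_adjoint by (rule complemented_annihilator[OF assms(1)])
  next
    assume "reflexive_space smul"
      "complemented_in dual_scale (dual_space smul) {f \<in> dual_space smul. normed_adjoint T f = 0}"
    from complemented_preannihilator[OF assms(1) this] show "complemented_in smul UNIV ?R"
      unfolding kernel_adjoint closed_range .
  next
    assume "reflexive_space smul"
      "complemented_in dual_scale (dual_space smul) (closure (normed_adjoint T ` dual_space smul))"
    from complemented_preannihilator[OF assms(1) this]
    show "complemented_in smul UNIV {x. blinfun_apply T x = 0}"
      unfolding kernel .
  next
    assume cl: "closed (range (blinfun_apply T))" and c: "complemented_in smul UNIV {x. blinfun_apply T x = 0}"
    note range = range_adjoint_eq_annihilator_kernel[OF assms cl]
    show "complemented_in dual_scale (dual_space smul) (normed_adjoint T ` dual_space smul)"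
      unfolding range by (rule complemented_annihilator[OF assms(1) c])
    show "closed (normed_adjoint T ` dual_space smul)"
      unfolding range using closed_subspace_annihilator by (auto simp: closed_subspace_of_def)
  qed
qed

end
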